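(* For every nonnegative integer $n$ let $$W_n=\sum_{k=0}^{n}\binom{n+k}{2k}\binom{2k}{k}\frac{3}{2k-3}.$$ Let $n$ be a positive integer and let $p>3$ be a prime. Then $$9\sum_{k=0}^{n-1}(2k+1)W_k^2 \equiv 0 \pmod{n},$$ and $$\sum_{k=0}^{p-1}(2k+1)W_k^2 \equiv 12p(-1)^{\frac{p-1}{2}}-17p^2 \pmod{p^3}.$$
   Context: For every nonnegative integer $k$, $\binom{2k}{k}\frac{3}{2k-3}$ is an integer, so each $W_n$ is an integer. *)

theory Defs
  imports "HOL-Number_Theory.Number_Theory"
begin

text \<open>
  The quotient \<open>3 * binom(2k, k) / (2k - 3)\<close> is always an integer, so \<open>div\<close> below is exact
  (including at \<open>k = 0, 1\<close>, where the divisor is negative); see \<open>of_int_W\<close>.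
\<close>

definition W :: "nat \<Rightarrow> int" where
  "W n = (\<Sum>k=0..n. int ((n + k) choose (2 * k)) *
            ((int ((2 * k) choose k) * 3) div (2 * int k - 3)))"

lemma central_binomial_step:
  "int (Suc k) * int ((2 * Suc k) choose Suc k) = 2 * (2 * int k + 1) * int ((2 * k) choose k)"
proof -
  have "Suc k * ((2 * Suc k) choose Suc k) = (2 * Suc k) * (Suc (2 * k) choose k)"
    using Suc_times_binomial_eq[of "Suc (2 * k)" k] by (simp add: mult.commute)
  moreover have "Suc k * (Suc (2 * k) choose k) = Suc (2 * k) * ((2 * k) choose k)"
  proof -
    have "Suc (2 * k) choose k = Suc (2 * k) choose Suc k"
      using binomial_symmetric[of k "Suc (2 * k)"] by simp
    then show ?thesis
      using Suc_times_binomial_eq[of "2 * k" k] by (simp add: mult.commute)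
  qed
  ultimately have "Suc k * ((2 * Suc k) choose Suc k) = 2 * (Suc (2 * k) * ((2 * k) choose k))"
    by (metis mult.assoc)
  then have "int (Suc k * ((2 * Suc k) choose Suc k)) = int (2 * (Suc (2 * k) * ((2 * k) choose k)))"
    by (rule arg_cong)
  then show ?thesis
    unfolding of_nat_mult by (simp add: algebra_simps)
qed

lemma dvd_three_central_binomial: "(2 * int k - 3) dvd int ((2 * k) choose k) * 3"
proof (cases "k < 2")
  case True
  then have "k = 0 \<or> k = 1" by auto
  then show ?thesis by auto
next
  case False
  then obtain j where k: "k = Suc (Suc j)"
    by (metis Suc_1 add_Suc le_Suc_ex not_less plus_1_eq_Suc)
  define C where "C = int ((2 * k) choose k)"
  define B where "B = int ((2 * Suc j) choose Suc j)"
  define A where "A = int ((2 * j) choose j)"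
  have 1: "(int j + 2) * C = 2 * (2 * int j + 3) * B"
    using central_binomial_step[of "Suc j"] unfolding B_def C_def k by (simp add: algebra_simps)
  have 2: "(int j + 1) * B = 2 * (2 * int j + 1) * A"
    using central_binomial_step[of j] unfolding A_def B_def by (simp add: algebra_simps)
  have "4 * (int j + 1) * (int j + 2) * C = 4 * (int j + 1) * (2 * (2 * int j + 3) * B)"
    unfolding 1[symmetric] by (simp only: mult.assoc)
  also have "\<dots> = 8 * (2 * int j + 3) * ((int j + 1) * B)"
    by (simp add: algebra_simps)
  also have "\<dots> = (2 * int j + 1) * (16 * (2 * int j + 3) * A)"
    unfolding 2 by (simp add: algebra_simps)
  finally have "C * 3 = (2 * int j + 1) * (16 * (2 * int j + 3) * A - (2 * int j + 5) * C)"
    by (simp add: algebra_simps)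
  moreover have "2 * int k - 3 = 2 * int j + 1" by (simp add: k)
  ultimately show ?thesis
    unfolding C_def[symmetric] by (metis dvd_triv_left)
qed

lemma of_int_W:
  "(of_int (W n) :: 'a :: field_char_0) =
     (\<Sum>k=0..n. of_nat ((n + k) choose (2 * k)) * of_nat ((2 * k) choose k) *
        (3 / (2 * of_nat k - 3)))"
proof -
  have "(of_int ((int ((2 * k) choose k) * 3) div (2 * int k - 3)) :: 'a)
          = of_nat ((2 * k) choose k) * (3 / (2 * of_nat k - 3))" for k
    using of_int_div[OF dvd_three_central_binomial[of k], where ?'a='a] by simp
  then show ?thesis
    unfolding W_def by (simp add: mult.assoc)
qed

end

theory Submission
  imports Defs
begin

text \<open>
  Let \<open>D n\<close> be the central Delannoy numbers, \<open>v = W n + D n\<close> and \<open>u = D n + D (n - 1)\<close>. The relation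
  \<open>(2n - 1) W (n+1) - (2n + 5) W n = 3 (D (n+1) + D n)\<close>, which holds summand by summand,
  and the three-term recurrence of \<open>D\<close> give a closed form: \<open>8 ((2n-1)(2n+1)(2n+3))\<^sup>2\<close> times the
  sum is a quadratic form in \<open>W n\<close>, \<open>D n\<close>, \<open>n u\<close> with coefficients in \<open>\<int>[n]\<close>, all of whose terms
  are divisible by \<open>n\<close>. Since \<open>((2n-1)(2n+1)(2n+3))\<^sup>2 \<equiv> 9 (mod n)\<close>, the first claim follows, the
  factor 8 being absorbed by the parity of \<open>u\<close>, \<open>v\<close>.

  For a prime \<open>n = p > 3\<close> the closed form reduces the second claim to \<open>D p\<close> modulo \<open>p\<close> and
  \<open>u\<close>, \<open>v\<close> modulo \<open>p\<^sup>2\<close>. In \<open>v\<close> the summands \<open>k\<close> and \<open>p + 3 - k\<close> cancel modulo \<open>p\<^sup>2\<close> for \<open>3 < k < p\<close>,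
  except for \<open>k = (p + 3) / 2\<close>, whose denominator \<open>2k - 3\<close> equals \<open>p\<close>; it produces the term
  with the sign \<open>(-1)\<^bsup>(p-1)/2\<^esup>\<close>.
\<close>

section \<open>Delannoy numbers and their relation to \<open>W\<close>\<close>

definition delannoy :: "nat \<Rightarrow> int" where
  "delannoy n = (\<Sum>k\<le>n. int ((n + k) choose (2 * k)) * int ((2 * k) choose k))"

definition W_coeff :: "nat \<Rightarrow> int" where
  "W_coeff k = (int ((2 * k) choose k) * 3) div (2 * int k - 3)"

lemma W_coeff: "(2 * int k - 3) * W_coeff k = 3 * int ((2 * k) choose k)"
  unfolding W_coeff_def using dvd_three_central_binomial[of k] by simp

text \<open>The added terms vanish, since \<open>k > n\<close> gives \<open>2 * k > n + k\<close>.
  Sums for different \<open>n\<close> can thus share one index range.\<close>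

lemma sum_binomial_extend:
  assumes "n \<le> N"
  shows "(\<Sum>k\<le>n. int ((n + k) choose (2 * k)) * f k) = (\<Sum>k\<le>N. int ((n + k) choose (2 * k)) * f k)"
  by (rule sum.mono_neutral_left) (use assms in auto)

lemma W_eq_sum: "W n = (\<Sum>k\<le>n. int ((n + k) choose (2 * k)) * W_coeff k)"
  unfolding W_def W_coeff_def by (simp add: atLeast0AtMost)

text \<open>Absorption, over the integers so that it holds for every \<open>k\<close>: at
  \<open>k = n + 1\<close> both sides are zero, and beyond that both binomials are.\<close>

lemma binomial_shift:
  "(int n + 1 - int k) * int ((Suc n + k) choose (2 * k)) = (int n + 1 + int k) * int ((n + k) choose (2 * k))"
proof (cases "k \<le> Suc n")
  case True
  have "(Suc n + k - 2 * k) * ((Suc n + k) choose (2 * k)) = (Suc n + k) * ((n + k) choose (2 * k))"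
    using binomial_absorb_comp[of "Suc n + k" "2 * k"] by simp
  moreover have "int (Suc n + k - 2 * k) = int n + 1 - int k" using True by simp
  ultimately show ?thesis
    by (metis (no_types, lifting) add.commute add.left_commute of_nat_Suc of_nat_add of_nat_mult)
qed (simp add: binomial_eq_0)

lemma W_delannoy_step:
  "(2 * int n - 1) * W (Suc n) - (2 * int n + 5) * W n = 3 * (delannoy (Suc n) + delannoy n)"
proof -
  let ?c = "\<lambda>k. int ((n + k) choose (2 * k))" and ?c' = "\<lambda>k. int ((Suc n + k) choose (2 * k))"
  let ?b = "\<lambda>k. int ((2 * k) choose k)"
  have summand: "(2 * int n - 1) * (?c' k * W_coeff k) - (2 * int n + 5) * (?c k * W_coeff k)
      = 3 * (?c' k * ?b k + ?c k * ?b k)" for k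
  proof -
    have "3 * (?c' k * ?b k + ?c k * ?b k) = (?c' k + ?c k) * ((2 * int k - 3) * W_coeff k)"
      unfolding W_coeff by (simp add: algebra_simps)
    \<comment> \<open>Here 2n - 1 = (2k - 3) + 2(n + 1 - k) and 2n + 5 = -(2k - 3) + 2(n + 1 + k);
      the leftover bracket vanishes by \<open>binomial_shift\<close>.\<close>
    also have "\<dots> = (2 * int n - 1) * (?c' k * W_coeff k) - (2 * int n + 5) * (?c k * W_coeff k)
        - 2 * W_coeff k * ((int n + 1 - int k) * ?c' k - (int n + 1 + int k) * ?c k)"
      by (simp add: algebra_simps)
    finally show ?thesis
      unfolding binomial_shift by simp
  qed
  have "W n = (\<Sum>k\<le>Suc n. ?c k * W_coeff k)" "delannoy n = (\<Sum>k\<le>Suc n. ?c k * ?b k)"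
    unfolding W_eq_sum delannoy_def by (rule sum_binomial_extend, simp)+
  then show ?thesis
    unfolding W_eq_sum[of "Suc n"] delannoy_def[of "Suc n"]
    by (simp only: sum_distrib_left sum_subtractf[symmetric] sum.distrib[symmetric] summand)
qed

section \<open>Three-term recurrence of the Delannoy numbers\<close>

text \<open>\<open>delannoy n\<close> is the value P_n(3) of a Legendre polynomial, and its summands
  are the coefficients of P_n(1 + 2x). This is the coefficient of x^(j+1) in (n+2) P_(n+2) + (n+1)
  P_n = (2n+3)(1 + 2x) P_(n+1).\<close>

lemma legendre_coeff_recurrence:
  "(int n + 2) * int ((n + 2 + Suc j) choose (2 * Suc j)) * int ((2 * Suc j) choose Suc j)
     + (int n + 1) * int ((n + Suc j) choose (2 * Suc j)) * int ((2 * Suc j) choose Suc j)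
   = (2 * int n + 3) * (int ((n + 1 + Suc j) choose (2 * Suc j)) * int ((2 * Suc j) choose Suc j)
       + 2 * int ((n + 1 + j) choose (2 * j)) * int ((2 * j) choose j))"
proof -
  \<comment> \<open>Pascal's rule brings all the upper binomials to row \<open>m\<close>; absorption
    then ties \<open>B\<close> to \<open>A\<close>.\<close>
  define m where "m = n + 1 + j"
  define A where "A = int (m choose (2 * j))"
  define B where "B = int (m choose (2 * j + 1))"
  define C where "C = int (m choose (2 * j + 2))"
  have c2: "int ((n + 2 + Suc j) choose (2 * Suc j)) = A + 2 * B + C"
    by (simp add: m_def A_def B_def C_def)
  have c1: "int ((n + 1 + Suc j) choose (2 * Suc j)) = B + C"
    by (simp add: m_def A_def B_def C_def)
  have c0: "int ((n + Suc j) choose (2 * Suc j)) = C"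
    by (simp add: m_def C_def)
  have b: "(int j + 1) * int ((2 * Suc j) choose Suc j) = 2 * (2 * int j + 1) * int ((2 * j) choose j)"
    using central_binomial_step[of j] by (simp add: algebra_simps)
  have "Suc (2 * j) * (m choose Suc (2 * j)) = (m - 2 * j) * (m choose (2 * j))"
    using binomial_absorption[of "2*j" m] binomial_absorb_comp[of m "2*j"] by simp
  then have "int (Suc (2 * j) * (m choose Suc (2 * j))) = int ((m - 2 * j) * (m choose (2 * j)))"
    by (rule arg_cong)
  moreover have "int ((m - 2 * j) * (m choose (2 * j))) = (int n + 1 - int j) * A"
    \<comment> \<open>For \<open>j > n + 1\<close> the truncated difference is 0, and
      \<open>A\<close> is 0 as well because \<open>m < 2 * j\<close>.\<close>
    unfolding A_def m_def by (cases "j \<le> n + 1") (auto simp: of_nat_diff)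
  ultimately have B: "(2 * int j + 1) * B = (int n + 1 - int j) * A"
    unfolding B_def by (simp add: algebra_simps)
  define X where "X = int ((2 * Suc j) choose Suc j)"
  define Z where "Z = int ((2 * j) choose j)"
  have "(int j + 1) * ((int n + 2) * (A + 2 * B + C) * X + (int n + 1) * C * X)
      = (int j + 1) * ((2 * int n + 3) * ((B + C) * X + 2 * A * Z))"
  proof -
    have "(int j + 1) * ((int n + 2) * (A + 2 * B + C) * X + (int n + 1) * C * X
        - (2 * int n + 3) * ((B + C) * X + 2 * A * Z))
      = ((int j + 1) * X) * ((int n + 2) * A + B) - 2 * (2 * int n + 3) * (int j + 1) * A * Z"
      by (simp add: algebra_simps)
    also have "\<dots> = 2 * Z * ((2 * int j + 1) * (int n + 2) * A + (2 * int j + 1) * B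
        - (2 * int n + 3) * (int j + 1) * A)"
      unfolding b[folded X_def Z_def] by (simp add: algebra_simps)
    also have "\<dots> = 0"
      unfolding B by (simp add: algebra_simps)
    finally show ?thesis by (simp add: algebra_simps)
  qed
  then have "(int n + 2) * (A + 2 * B + C) * X + (int n + 1) * C * X
      = (2 * int n + 3) * ((B + C) * X + 2 * A * Z)"
    by simp
  then show ?thesis
    unfolding c0 c1 c2 X_def Z_def A_def m_def by simp
qed

lemma delannoy_recurrence:
  "(int n + 2) * delannoy (n + 2) + (int n + 1) * delannoy n = 3 * (2 * int n + 3) * delannoy (n + 1)"
proof -
  let ?b = "\<lambda>k. int ((2 * k) choose k)"
  let ?a = "\<lambda>m k. int ((m + k) choose (2 * k)) * ?b k"
  define s where "s m = (\<Sum>j\<le>n + 1. ?a m (Suc j))" for m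
  \<comment> \<open>The coefficient recurrence covers only positive powers of x. The constant terms,
    all 1, match because (n+2) + (n+1) = 2n+3.\<close>
  have d: "delannoy m = 1 + s m" if "m \<le> n + 2" for m
  proof -
    have "delannoy m = (\<Sum>k\<le>Suc (n + 1). ?a m k)"
      unfolding delannoy_def using sum_binomial_extend[of m "Suc (n+1)" ?b] that by simp
    then show ?thesis
      by (subst (asm) sum.atMost_Suc_shift) (simp add: s_def)
  qed
  have "(int n + 2) * s (n + 2) + (int n + 1) * s n
     = (2 * int n + 3) * (s (n + 1) + 2 * (\<Sum>j\<le>n + 1. ?a (n + 1) j))"
    unfolding s_def sum_distrib_left sum.distrib[symmetric]
    by (rule sum.cong[OF refl]) (use legendre_coeff_recurrence in \<open>simp only: mult.assoc\<close>)
  also have "(\<Sum>j\<le>n + 1. ?a (n + 1) j) = delannoy (n + 1)"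
    by (simp add: delannoy_def)
  finally show ?thesis
    using d[of n] d[of "n+1"] d[of "n+2"] by (simp add: algebra_simps)
qed

section \<open>Closed form of the weighted sum of squares\<close>

text \<open>
  The coefficients were found by linear algebra from numerical values of the sum. The last
  argument stands for \<open>n (D n + D (n - 1))\<close>: with it, the induction step needs no division by \<open>n + 1\<close>.
\<close>
definition closed_form :: "int \<Rightarrow> int \<Rightarrow> int \<Rightarrow> int \<Rightarrow> int" where
  "closed_form n w d u =
     n^2 * (360 - 944*n^2 + 640*n^4 - 128*n^6) * w^2
     + n^2 * (720 + 480*n - 576*n^2 - 384*n^3 + 1152*n^4 + 768*n^5) * w * d
     + (108 + 72*n - 120*n^2 - 576*n^3 - 768*n^4 - 576*n^5 - 192*n^6) * w * u
     + n^4 * (2592 + 3456*n + 1152*n^2) * d^2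
     + (108 + 504*n + 720*n^2 - 2304*n^3 - 4320*n^4 - 1728*n^5) * d * u
     + (- 9 - 144*n + 72*n^2 + 432*n^3 + 216*n^4) * u^2"

text \<open>\<open>Groebner_Basis\<close> is spelled out because HOL-Algebra redefines the method name \<open>algebra\<close>.\<close>
lemma closed_form_step:
  fixes n w d w' s :: int
  assumes "(2 * n - 1) * w' = (2 * n + 5) * w + 3 * s"
  shows "(2 * n - 1)^2 * closed_form (n + 1) w' (s - d) ((n + 1) * s)
    = (2 * n + 5)^2 * (closed_form n w d ((8 * n + 4) * d - (n + 1) * s)
        - 8 * ((2 * n - 1) * (2 * n + 1) * (2 * n + 3))^2 * (2 * n + 1) * w^2)"
proof -
  \<comment> \<open>Only this multiple of \<open>w'\<close> is given by the hypothesis. The form is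
    quadratic in \<open>w'\<close>, hence the factor \<open>(2 * n - 1)^2\<close>.\<close>
  define x where "x = (2 * n - 1) * w'"
  define n' where "n' = n + 1"
  define d' where "d' = s - d"
  have "(2 * n - 1)^2 * closed_form n' w' d' (n' * s)
    = n'^2 * (360 - 944*n'^2 + 640*n'^4 - 128*n'^6) * x^2
     + (2*n-1) * n'^2 * (720 + 480*n' - 576*n'^2 - 384*n'^3 + 1152*n'^4 + 768*n'^5) * x * d'
     + (2*n-1) * (108 + 72*n' - 120*n'^2 - 576*n'^3 - 768*n'^4 - 576*n'^5 - 192*n'^6) * x * (n'*s)
     + (2*n-1)^2 * (n'^4 * (2592 + 3456*n' + 1152*n'^2) * d'^2
     + (108 + 504*n' + 720*n'^2 - 2304*n'^3 - 4320*n'^4 - 1728*n'^5) * d' * (n'*s)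
     + (- 9 - 144*n' + 72*n'^2 + 432*n'^3 + 216*n'^4) * (n'*s)^2)"
    unfolding closed_form_def x_def by Groebner_Basis.algebra
  also have "\<dots> = (2 * n + 5)^2 * (closed_form n w d ((8 * n + 4) * d - (n + 1) * s)
        - 8 * ((2 * n - 1) * (2 * n + 1) * (2 * n + 3))^2 * (2 * n + 1) * w^2)"
    unfolding x_def assms closed_form_def n'_def d'_def by Groebner_Basis.algebra
  finally show ?thesis unfolding n'_def d'_def .
qed

text \<open>The three-term recurrence, solved for the last argument of \<open>closed_form\<close> at
  \<open>n\<close> in terms of data available at \<open>n + 1\<close>.\<close>

lemma delannoy_sum_step:
  "int n * (delannoy n + delannoy (n - 1))
    = (8 * int n + 4) * delannoy n - (int n + 1) * (delannoy (Suc n) + delannoy n)"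
proof (cases n)
  case 0
  then show ?thesis by (simp add: delannoy_def numeral_2_eq_2)
next
  case (Suc m)
  then show ?thesis using delannoy_recurrence[of m] by (simp add: algebra_simps)
qed

lemma sum_W_squared:
  "8 * ((2 * int n - 1) * (2 * int n + 1) * (2 * int n + 3))^2 * (\<Sum>k<n. (2 * int k + 1) * (W k)^2)
    = - closed_form (int n) (W n) (delannoy n) (int n * (delannoy n + delannoy (n - 1)))"
proof (induction n)
  case 0
  then show ?case by (simp add: closed_form_def)
next
  case (Suc n)
  define N where "N = int n"
  define S where "S = (\<Sum>k<n. (2 * int k + 1) * (W k)^2)"
  define s where "s = delannoy (Suc n) + delannoy n"
  let ?q = "\<lambda>N::int. ((2 * N - 1) * (2 * N + 1) * (2 * N + 3))^2"
  have W: "(2 * N - 1) * W (Suc n) = (2 * N + 5) * W n + 3 * s"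
    using W_delannoy_step[of n] by (simp add: N_def s_def)
  have IH: "8 * ?q N * S = - closed_form N (W n) (delannoy n) ((8 * N + 4) * delannoy n - (N + 1) * s)"
    using Suc.IH unfolding delannoy_sum_step N_def s_def S_def .
  \<comment> \<open>Passing from \<open>N\<close> to \<open>N + 1\<close> replaces the factor 2N - 1
    of the product by 2N + 5.\<close>
  have "(2 * N - 1)^2 * (8 * ?q (N + 1) * (S + (2 * N + 1) * (W n)^2))
      = (2 * N + 5)^2 * (8 * ?q N * S + 8 * ?q N * (2 * N + 1) * (W n)^2)"
    by Groebner_Basis.algebra
  also have "\<dots> = - ((2 * N - 1)^2 * closed_form (N + 1) (W (Suc n)) (s - delannoy n) ((N + 1) * s))"
    unfolding IH closed_form_step[OF W] by (simp add: algebra_simps)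
  finally have "(2 * N - 1)^2 * (8 * ?q (N + 1) * (S + (2 * N + 1) * (W n)^2))
     = (2 * N - 1)^2 * (- closed_form (N + 1) (W (Suc n)) (s - delannoy n) ((N + 1) * s))"
    by simp
  moreover have "(2 * N - 1)^2 \<noteq> 0" by (simp, presburger)
  ultimately have "8 * ?q (N + 1) * (S + (2 * N + 1) * (W n)^2)
     = - closed_form (N + 1) (W (Suc n)) (s - delannoy n) ((N + 1) * s)"
    by (metis mult_left_cancel)
  moreover have "s - delannoy n = delannoy (Suc n)" "N + 1 = int (Suc n)"
    "s = delannoy (Suc n) + delannoy (Suc n - 1)"
    "S + (2 * N + 1) * (W n)^2 = (\<Sum>k<Suc n. (2 * int k + 1) * (W k)^2)"
    by (simp_all add: s_def N_def S_def)
  ultimately show ?case by metis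
qed

section \<open>Parity and divisibility by n\<close>

text \<open>By Pascal's rule it is the sum of two entries that are equal by symmetry.\<close>

lemma even_central_binomial:
  assumes "k > 0"
  shows "even (int ((2 * k) choose k))"
proof -
  obtain j where "k = Suc j" using assms gr0_implies_Suc by blast
  moreover have "Suc (2 * j) choose j = Suc (2 * j) choose Suc j"
    using binomial_symmetric[of j "Suc (2 * j)"] by simp
  ultimately show ?thesis by simp
qed

lemma odd_delannoy: "odd (delannoy n)"
proof -
  have "delannoy n = 1 + (\<Sum>k\<in>{0<..n}. int ((n + k) choose (2 * k)) * int ((2 * k) choose k))"
    unfolding delannoy_def by (simp add: sum.head atMost_atLeast0)
  moreover have "even (\<Sum>k\<in>{0<..n}. int ((n + k) choose (2 * k)) * int ((2 * k) choose k))"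
    by (rule dvd_sum) (use even_central_binomial in auto)
  ultimately show ?thesis by simp
qed

lemma W_plus_delannoy:
  "W n + delannoy n = (\<Sum>k\<le>n. int ((n + k) choose (2 * k)) * (W_coeff k + int ((2 * k) choose k)))"
  unfolding W_eq_sum delannoy_def by (simp add: sum.distrib algebra_simps)

text \<open>Adding the Delannoy number pays off because 3/(2k-3) + 1 = 2k/(2k-3): the numerator
  becomes even and supplies a factor k.\<close>

lemma W_coeff_plus: "(2 * int k - 3) * (W_coeff k + int ((2 * k) choose k)) = 2 * int k * int ((2 * k) choose k)"
  using W_coeff[of k] by (simp add: algebra_simps)

lemma even_W_plus_delannoy: "even (W n + delannoy n)"
  unfolding W_plus_delannoy
proof (rule dvd_sum)
  fix k
  have "even ((2 * int k - 3) * (W_coeff k + int ((2 * k) choose k)))"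
    unfolding W_coeff_plus by simp
  then show "even (int ((n + k) choose (2 * k)) * (W_coeff k + int ((2 * k) choose k)))"
    by simp
qed

text \<open>The terms up to n^2 are explicit, as they decide the sum modulo n^3. Apart from
  \<open>108 * u * (w + d)\<close> and \<open>9 * u^2\<close>, which are left to parity arguments,
  everything shows a factor 8.\<close>

lemma closed_form_expansion:
  "\<exists>R. closed_form n w d (n * u) =
     n * (108 * u * (w + d)
       + n * (8 * (45 * (w + d)^2 - 45 * d^2 + 9 * u * (w + d) + 54 * d * u) - 9 * u^2)
       + n^2 * (8 * R))"
proof
  show "closed_form n w d (n * u) =
     n * (108 * u * (w + d)
       + n * (8 * (45 * (w + d)^2 - 45 * d^2 + 9 * u * (w + d) + 54 * d * u) - 9 * u^2)
       + n^2 * (8 * ((- 118*n + 80*n^3 - 16*n^5) * (w + d)^2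
         + (60 + 164*n - 48*n^2 - 16*n^3 + 96*n^4 + 32*n^5) * d * (w + d)
         + (- 60 + 278*n + 480*n^2 + 80*n^3 - 96*n^4 - 16*n^5) * d^2
         + (- 15 - 72*n - 96*n^2 - 72*n^3 - 24*n^4) * u * (w + d)
         + (105 - 216*n - 444*n^2 - 144*n^3 + 24*n^4) * d * u
         + (- 18 + 9*n + 54*n^2 + 27*n^3) * u^2)))"
    unfolding closed_form_def by Groebner_Basis.algebra
qed

lemma dvd_nine_sum:
  assumes "n > 0"
  shows "int n dvd 9 * (\<Sum>k<n. (2 * int k + 1) * (W k)^2)"
proof -
  define N where "N = int n"
  define S where "S = (\<Sum>k<n. (2 * int k + 1) * (W k)^2)"
  define u where "u = delannoy n + delannoy (n - 1)"
  define v where "v = W n + delannoy n"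
  define d where "d = delannoy n"
  have "8 * ((2 * N - 1) * (2 * N + 1) * (2 * N + 3))^2 * S = - closed_form N (W n) d (N * u)"
    using sum_W_squared[of n] by (simp add: N_def S_def u_def d_def)
  moreover have "W n + d = v" by (simp add: v_def d_def)
  ultimately obtain R where R: "8 * ((2 * N - 1) * (2 * N + 1) * (2 * N + 3))^2 * S
      = - (N * (108 * u * v + N * (8 * (45 * v^2 - 45 * d^2 + 9 * u * v + 54 * d * u) - 9 * u^2) + N^2 * (8 * R)))"
    using closed_form_expansion[of N "W n" d u] by metis
  have "even u" "even v"
    unfolding u_def v_def using odd_delannoy even_W_plus_delannoy by auto
  then obtain x y where xy: "u = 2 * x" "v = 2 * y" by (elim evenE)
  have "N dvd ((2 * N - 1) * (2 * N + 1) * (2 * N + 3))^2 * S"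
  \<comment> \<open>For N = 2m the evenness of \<open>u\<close> and \<open>v\<close> gives 108uv = 8
    * 54xy and 9Nu^2 = 8 * 9mx^2, so 8 cancels. For odd N it is invertible modulo N.\<close>
  proof (cases "even N")
    case True
    then obtain m where m: "N = 2 * m" by (elim evenE)
    have "8 * (((2 * N - 1) * (2 * N + 1) * (2 * N + 3))^2 * S)
      = 8 * (N * - (54 * x * y + N * (45 * v^2 - 45 * d^2 + 9 * u * v + 54 * d * u) - 9 * m * x^2 + N^2 * R))"
      using R unfolding xy m by Groebner_Basis.algebra
    then show ?thesis by simp
  next
    case False
    have "N dvd 8 * (((2 * N - 1) * (2 * N + 1) * (2 * N + 3))^2 * S)"
      using R by (simp add: mult.assoc)
    moreover have "coprime N 8"
      using False coprime_power_right_iff[of N 2 3] by simp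
    ultimately show ?thesis by (simp add: coprime_dvd_mult_right_iff)
  qed
  moreover have "((2 * N - 1) * (2 * N + 1) * (2 * N + 3))^2 * S
     = N * ((12 - 68*N - 96*N^2 + 112*N^3 + 192*N^4 + 64*N^5) * S) + 9 * S"
    by Groebner_Basis.algebra
  ultimately show ?thesis
    unfolding N_def[symmetric] S_def[symmetric] by (simp add: dvd_add_right_iff)
qed

section \<open>Binomial products modulo the square of a prime\<close>

text \<open>In the ratio of consecutive products the terms linear in n cancel: (n-k-1)(n+k+1) = n^2
  - (k+1)^2. For n = p the ratio is thus -1 modulo p^2.\<close>

lemma binomial_product_step:
  assumes "n > 0"
  shows "(int k + 1)^2 * (int ((n - 1) choose Suc k) * int ((n + Suc k) choose Suc k))
    = ((int n)^2 - (int k + 1)^2) * (int ((n - 1) choose k) * int ((n + k) choose k))"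
proof -
  have "int (Suc k * ((n - 1) choose Suc k)) = int ((n - 1 - k) * ((n - 1) choose k))"
    using binomial_absorption[of k "n - 1"] binomial_absorb_comp[of "n - 1" k] by simp
  also have "\<dots> = (int n - 1 - int k) * int ((n - 1) choose k)"
    using assms by (cases "k \<le> n - 1") (auto simp: of_nat_diff)
  finally have 1: "(int k + 1) * int ((n - 1) choose Suc k) = (int n - 1 - int k) * int ((n - 1) choose k)"
    by (simp add: algebra_simps)
  have "int (Suc (n + k) * ((n + k) choose k)) = int ((Suc (n + k) choose Suc k) * Suc k)"
    by (simp only: Suc_times_binomial_eq)
  then have 2: "(int k + 1) * int ((n + Suc k) choose Suc k) = (int n + int k + 1) * int ((n + k) choose k)"
    unfolding of_nat_mult by (simp add: algebra_simps)
  have "(int k + 1)^2 * (int ((n - 1) choose Suc k) * int ((n + Suc k) choose Suc k))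
    = ((int k + 1) * int ((n - 1) choose Suc k)) * ((int k + 1) * int ((n + Suc k) choose Suc k))"
    by (simp only: power2_eq_square mult_ac)
  also have "\<dots> = ((int n)^2 - (int k + 1)^2) * (int ((n - 1) choose k) * int ((n + k) choose k))"
    unfolding 1 2 by (simp add: algebra_simps power2_eq_square)
  finally show ?thesis .
qed

text \<open>The coefficient equals binom(n+k, k) binom(n, k) with k = j + 1; absorption in both
  factors isolates n and leaves the product treated above.\<close>

lemma legendre_coeff_product:
  assumes "Suc j \<le> n"
  shows "(int j + 1)^2 * (int ((n + Suc j) choose (2 * Suc j)) * int ((2 * Suc j) choose Suc j))
    = int n * (int n + int j + 1) * (int ((n - 1) choose j) * int ((n + j) choose j))"
proof -
  have "((n + Suc j) choose (2 * Suc j)) * ((2 * Suc j) choose Suc j)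
      = ((n + Suc j) choose Suc j) * (n choose Suc j)"
    using choose_mult[of "Suc j" "2 * Suc j" "n + Suc j"] assms by simp
  then have "(Suc j)^2 * (((n + Suc j) choose (2 * Suc j)) * ((2 * Suc j) choose Suc j))
      = (Suc j * ((n + Suc j) choose Suc j)) * (Suc j * (n choose Suc j))"
    by (simp only: power2_eq_square mult_ac)
  also have "Suc j * (n choose Suc j) = n * ((n - 1) choose j)"
    by (rule binomial_absorption)
  also have "Suc j * ((n + Suc j) choose Suc j) = (n + Suc j) * ((n + j) choose j)"
    using binomial_absorption[of j "n + Suc j"] by simp
  finally have "int ((Suc j)^2 * (((n + Suc j) choose (2 * Suc j)) * ((2 * Suc j) choose Suc j)))
      = int ((n + Suc j) * ((n + j) choose j) * (n * ((n - 1) choose j)))"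
    by (rule arg_cong)
  then show ?thesis
    unfolding of_nat_mult of_nat_power by (simp add: algebra_simps)
qed

context
  fixes p :: nat
  assumes prime: "prime p" and gt3: "p > 3"
begin

lemma coprime_int_prime_power:
  assumes "\<not> int p dvd x"
  shows "coprime x (int p ^ m)"
proof -
  have "coprime (int p) x" using assms prime by (intro prime_imp_coprime) simp_all
  then show ?thesis by (simp add: coprime_commute)
qed

lemma coprime_small: "0 < k \<Longrightarrow> k < p \<Longrightarrow> coprime (int k) (int p ^ m)"
  by (rule coprime_int_prime_power) (auto dest: zdvd_imp_le)

lemma binomial_product_cong:
  "k < p \<Longrightarrow> [int ((p - 1) choose k) * int ((p + k) choose k) = (-1) ^ k] (mod int p ^ 2)"
proof (induction k)
  case (Suc k)
  have "[(int k + 1)^2 * (int ((p - 1) choose Suc k) * int ((p + Suc k) choose Suc k))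
    = (0 - (int k + 1)^2) * (-1) ^ k] (mod int p ^ 2)"
    unfolding binomial_product_step[OF less_trans[OF zero_less_Suc Suc.prems]]
    by (intro cong_mult cong_diff cong_refl Suc.IH) (use Suc.prems in \<open>auto simp: cong_0_iff\<close>)
  then have "[(int k + 1)^2 * (int ((p - 1) choose Suc k) * int ((p + Suc k) choose Suc k))
    = (int k + 1)^2 * (-1) ^ Suc k] (mod int p ^ 2)"
    by simp
  moreover have "coprime ((int k + 1)^2) (int p ^ 2)"
    using coprime_small[of "Suc k" 2] Suc.prems by (simp add: add.commute)
  ultimately show ?case by (simp only: cong_mult_lcancel)
qed simp

text \<open>The case k = p of \<open>legendre_coeff_product\<close>, where p^2 cancels exactly and
  the remaining product is 1 modulo p^2 because p - 1 is even.\<close>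

lemma central_binomial_cong: "[int ((2 * p) choose p) = 2] (mod int p ^ 2)"
proof -
  obtain j where "p = Suc j" using gt3 by (cases p) auto
  then have j: "Suc j = p" "int j + 1 = int p" "int p + int j + 1 = 2 * int p" "p + p = 2 * p" by simp_all
  define b where "b = int ((p - 1) choose j) * int ((p + j) choose j)"
  have "(int p)^2 * int ((2 * p) choose p) = (int p)^2 * (2 * b)"
    using legendre_coeff_product[of j p] unfolding j b_def[symmetric]
    by (simp add: power2_eq_square)
  then have "int ((2 * p) choose p) = 2 * b"
    using gt3 by simp
  moreover have "even j" using prime_odd_nat[OF prime] gt3 j(1) by auto
  moreover have "[b = (-1) ^ j] (mod int p ^ 2)"
    unfolding b_def using j(1) by (intro binomial_product_cong) simp
  ultimately show ?thesis
    using cong_scalar_left[of b 1 "int p ^ 2" 2] by simp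
qed

lemma prime_dvd_legendre_coeff:
  assumes "0 < k" "k < p"
  shows "int p dvd int ((p + k) choose (2 * k)) * int ((2 * k) choose k)"
proof -
  obtain j where j: "k = Suc j" using assms gr0_implies_Suc by blast
  have "int p dvd (int k)^2 * (int ((p + k) choose (2 * k)) * int ((2 * k) choose k))"
    using legendre_coeff_product[of j p] assms unfolding j by (simp add: add.commute)
  moreover have "coprime (int p) ((int k)^2)"
    using coprime_small[of k 1] assms by (simp add: coprime_commute)
  ultimately show ?thesis by (simp only: coprime_dvd_mult_right_iff)
qed

section \<open>Delannoy numbers at a prime\<close>

lemma sum_split_ends:
  fixes f :: "nat \<Rightarrow> int"
  shows "(\<Sum>k\<le>p. f k) = f 0 + f p + (\<Sum>k\<in>{0<..<p}. f k)"
proof -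
  have "{..p} = insert 0 (insert p {0<..<p})" using gt3 by auto
  then show ?thesis using gt3 by simp
qed

lemma delannoy_cong: "[delannoy p = 3] (mod int p)"
proof -
  let ?a = "\<lambda>k. int ((p + k) choose (2 * k)) * int ((2 * k) choose k)"
  have "[(\<Sum>k\<in>{0<..<p}. ?a k) = 0] (mod int p)"
    unfolding cong_0_iff by (rule dvd_sum) (use prime_dvd_legendre_coeff in auto)
  moreover have "[int ((2 * p) choose p) = 2] (mod int p)"
    using central_binomial_cong by (rule cong_dvd_modulus) (simp add: power2_eq_square)
  ultimately have "[1 + int ((2 * p) choose p) + (\<Sum>k\<in>{0<..<p}. ?a k) = 1 + 2 + 0] (mod int p)"
    by (intro cong_add cong_refl)
  then show ?thesis
    unfolding delannoy_def sum_split_ends by (simp add: mult_2[symmetric])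
qed

text \<open>For 0 < k < p the two summands a, a' satisfy (p-k)a = (p+k)a', so (p+k)(a+a') = 2pa, and
  a brings a second factor p. Only k = 0 and k = p survive.\<close>

lemma delannoy_sum_cong: "[delannoy p + delannoy (p - 1) = 4] (mod int p ^ 2)"
proof -
  let ?a = "\<lambda>k. int ((p + k) choose (2 * k)) * int ((2 * k) choose k)"
  let ?a' = "\<lambda>k. int ((p - 1 + k) choose (2 * k)) * int ((2 * k) choose k)"
  have "int p ^ 2 dvd ?a k + ?a' k" if k: "k \<in> {0<..<p}" for k
  proof -
    have "(int p - int k) * int ((p + k) choose (2 * k)) = (int p + int k) * int ((p - 1 + k) choose (2 * k))"
      using binomial_shift[of "p - 1" k] gt3 by (simp add: of_nat_diff)
    then have "(int p + int k) * (?a k + ?a' k) = 2 * int p * ?a k"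
      by Groebner_Basis.algebra
    moreover have "int p ^ 2 dvd 2 * int p * ?a k"
      using prime_dvd_legendre_coeff[of k] k
      by (metis (no_types, lifting) greaterThanLessThan_iff dvd_mult dvd_mult_left mult_dvd_mono dvd_refl mult.assoc power2_eq_square)
    moreover have "coprime (int p ^ 2) (int p + int k)"
    proof -
      have "\<not> int p dvd int p + int k"
        using k by (auto dest: zdvd_imp_le)
      then show ?thesis using coprime_int_prime_power coprime_commute by blast
    qed
    ultimately show ?thesis by (metis coprime_dvd_mult_right_iff)
  qed
  then have "[(\<Sum>k\<in>{0<..<p}. ?a k + ?a' k) = 0] (mod int p ^ 2)"
    unfolding cong_0_iff by (rule dvd_sum)
  then have "[2 + int ((2 * p) choose p) + (\<Sum>k\<in>{0<..<p}. ?a k + ?a' k) = 2 + 2 + 0] (mod int p ^ 2)"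
    by (intro cong_add cong_refl central_binomial_cong)
  moreover have "delannoy p + delannoy (p - 1) = (\<Sum>k\<le>p. ?a k + ?a' k)"
    using sum_binomial_extend[of "p - 1" p "\<lambda>k. int ((2 * k) choose k)"]
    by (simp add: delannoy_def sum.distrib)
  moreover have "(\<Sum>k\<le>p. ?a k + ?a' k) = 2 + int ((2 * p) choose p) + (\<Sum>k\<in>{0<..<p}. ?a k + ?a' k)"
    using gt3 unfolding sum_split_ends by (simp add: mult_2[symmetric] binomial_eq_0)
  ultimately show ?thesis by simp
qed

section \<open>\<open>W p + delannoy p\<close> modulo p^2\<close>

definition W_delannoy_term :: "nat \<Rightarrow> int" where
  "W_delannoy_term k = int ((p + k) choose (2 * k)) * (W_coeff k + int ((2 * k) choose k))"

lemma W_delannoy_term_eq: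
  "(2 * int k - 3) * W_delannoy_term k = 2 * int k * (int ((p + k) choose (2 * k)) * int ((2 * k) choose k))"
proof -
  have "(2 * int k - 3) * W_delannoy_term k
     = int ((p + k) choose (2 * k)) * ((2 * int k - 3) * (W_coeff k + int ((2 * k) choose k)))"
    unfolding W_delannoy_term_def by (simp only: mult_ac)
  then show ?thesis unfolding W_coeff_plus by (simp only: mult_ac)
qed

lemma W_delannoy_term_product:
  assumes "Suc j \<le> p"
  shows "(int j + 1) * ((2 * int j - 1) * W_delannoy_term (Suc j))
    = 2 * int p * (int p + int j + 1) * (int ((p - 1) choose j) * int ((p + j) choose j))"
proof -
  define a where "a = int ((p + Suc j) choose (2 * Suc j)) * int ((2 * Suc j) choose Suc j)"
  have "(2 * int j - 1) * W_delannoy_term (Suc j) = 2 * (int j + 1) * a"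
    using W_delannoy_term_eq[of "Suc j", folded a_def] by (simp add: algebra_simps)
  then have "(int j + 1) * ((2 * int j - 1) * W_delannoy_term (Suc j)) = 2 * ((int j + 1)^2 * a)"
    by (simp add: power2_eq_square)
  then show ?thesis
    unfolding a_def legendre_coeff_product[OF assms] by (simp only: mult_ac)
qed

lemma W_delannoy_term_cong:
  assumes "0 < k" "k < p"
  shows "[(2 * int k - 3) * W_delannoy_term k = - 2 * int p * (-1) ^ k] (mod int p ^ 2)"
proof -
  obtain j where j: "k = Suc j" using assms gr0_implies_Suc by blast
  have "[2 * int p * (int p + int j + 1) * (int ((p - 1) choose j) * int ((p + j) choose j))
     = 2 * int p * (int p + int j + 1) * (-1) ^ j] (mod int p ^ 2)"
    by (intro cong_mult cong_refl binomial_product_cong) (use assms j in simp)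
  \<comment> \<open>The factor p in front removes the summand p in the bracket, so that j + 1 can be
    cancelled.\<close>
  also have "[2 * int p * (int p + int j + 1) * (-1) ^ j = (int j + 1) * (2 * int p * (-1) ^ j)] (mod int p ^ 2)"
    by (simp add: cong_iff_dvd_diff algebra_simps power2_eq_square)
  finally have "[(int j + 1) * ((2 * int j - 1) * W_delannoy_term (Suc j)) = (int j + 1) * (2 * int p * (-1) ^ j)] (mod int p ^ 2)"
    using W_delannoy_term_product[of j] assms j by simp
  moreover have "coprime (int j + 1) (int p ^ 2)"
    using coprime_small[of k 2] assms j by (simp add: add.commute)
  ultimately have "[(2 * int j - 1) * W_delannoy_term (Suc j) = 2 * int p * (-1) ^ j] (mod int p ^ 2)"
    by (simp only: cong_mult_lcancel)
  then show ?thesis by (simp add: j)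
qed

text \<open>The odd number 2k - 3 lies strictly between -p and 2p, so the only multiple of p it
  could be is p itself, which is excluded.\<close>

lemma prime_dvd_W_delannoy_term:
  assumes "0 < k" "k < p" "2 * k \<noteq> p + 3"
  shows "\<not> int p dvd 2 * int k - 3" "int p dvd W_delannoy_term k"
proof -
  show *: "\<not> int p dvd 2 * int k - 3"
  proof
    assume "int p dvd 2 * int k - 3"
    then obtain m where m: "2 * int k - 3 = int p * m" by (elim dvdE)
    have "int p * m < int p * 2" "int p * m > int p * (- 1)"
      using m assms gt3 by linarith+
    then have "m < 2" "m > - 1"
      using gt3 by (simp_all only: mult_less_cancel_left)
    then have "m = 0 \<or> m = 1" by linarith
    then show False
    proof
      assume "m = 0" then show False using m by presburger
    next
      assume "m = 1" then show False using m assms by simp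
    qed
  qed
  have "[(2 * int k - 3) * W_delannoy_term k = - 2 * int p * (-1) ^ k] (mod int p)"
    using W_delannoy_term_cong[OF assms(1,2)] by (rule cong_dvd_modulus) (simp add: power2_eq_square)
  moreover have "[- 2 * int p * (-1) ^ k = 0] (mod int p)" by (simp add: cong_0_iff)
  ultimately have "int p dvd (2 * int k - 3) * W_delannoy_term k"
    using cong_trans cong_0_iff by blast
  then show "int p dvd W_delannoy_term k"
    using * prime by (simp add: prime_dvd_mult_iff)
qed

text \<open>For k' = p + 3 - k the denominators satisfy 2k' - 3 = 2p - (2k - 3), so they are
  opposite modulo p, while the signs agree since p + 3 is even. Both terms are multiples of p, so
  this suffices modulo p^2. The bound k > 3 keeps k' below p.\<close>

lemma W_delannoy_term_pair:
  assumes "3 < k" "k < p" "2 * k \<noteq> p + 3"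
  shows "int p ^ 2 dvd W_delannoy_term k + W_delannoy_term (p + 3 - k)"
proof -
  define k' where "k' = p + 3 - k"
  have k': "0 < k'" "k' < p" "2 * k' \<noteq> p + 3" "int k' = int p + 3 - int k"
    using assms by (auto simp: k'_def)
  have "odd p" using prime_odd_nat[OF prime] gt3 by simp
  then have "even (k + k')" using assms by (simp add: k'_def)
  then have sgn: "(-1::int) ^ k' = (-1) ^ k" by (simp add: minus_one_power_iff)
  have "[2 * (int p * W_delannoy_term k') = 0] (mod int p ^ 2)"
    unfolding cong_0_iff power2_eq_square using prime_dvd_W_delannoy_term(2)[OF k'(1-3)] by simp
  moreover have "[(2 * int k - 3) * W_delannoy_term k = - 2 * int p * (-1) ^ k] (mod int p ^ 2)"
    "[(2 * int k' - 3) * W_delannoy_term k' = - 2 * int p * (-1) ^ k] (mod int p ^ 2)"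
    using W_delannoy_term_cong[of k] W_delannoy_term_cong[of k'] assms k' sgn by simp_all
  ultimately have "[(2 * int k - 3) * W_delannoy_term k - (2 * int k' - 3) * W_delannoy_term k' + 2 * (int p * W_delannoy_term k')
     = - 2 * int p * (-1) ^ k - (- 2 * int p * (-1) ^ k) + 0] (mod int p ^ 2)"
    by (intro cong_add cong_diff)
  moreover have "(2 * int k - 3) * W_delannoy_term k - (2 * int k' - 3) * W_delannoy_term k' + 2 * (int p * W_delannoy_term k')
    = (2 * int k - 3) * (W_delannoy_term k + W_delannoy_term k')"
    unfolding k'(4) by (simp add: algebra_simps)
  ultimately have "int p ^ 2 dvd (2 * int k - 3) * (W_delannoy_term k + W_delannoy_term k')"
    by (simp add: cong_0_iff)
  moreover have "coprime (int p ^ 2) (2 * int k - 3)"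
    using coprime_int_prime_power[of "2 * int k - 3" 2] prime_dvd_W_delannoy_term(1)[of k] assms
    by (metis coprime_commute less_trans zero_less_numeral)
  ultimately show ?thesis
    unfolding k'_def[symmetric] by (simp only: coprime_dvd_mult_right_iff)
qed

lemma W_delannoy_term_pairs_sum:
  "int p ^ 2 dvd (\<Sum>k\<in>{k. 3 < k \<and> k < p \<and> 2 * k \<noteq> p + 3}. W_delannoy_term k)"
proof -
  let ?A = "{k. 3 < k \<and> k < p \<and> 2 * k \<noteq> p + 3}"
  have "(\<Sum>k\<in>?A. W_delannoy_term k) = (\<Sum>k\<in>?A. W_delannoy_term (p + 3 - k))"
    by (rule sum.reindex_bij_witness[of _ "\<lambda>k. p + 3 - k" "\<lambda>k. p + 3 - k"]) auto
  then have "2 * (\<Sum>k\<in>?A. W_delannoy_term k) = (\<Sum>k\<in>?A. W_delannoy_term k + W_delannoy_term (p + 3 - k))"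
    by (simp add: sum.distrib)
  moreover have "int p ^ 2 dvd (\<Sum>k\<in>?A. W_delannoy_term k + W_delannoy_term (p + 3 - k))"
    by (rule dvd_sum) (use W_delannoy_term_pair in auto)
  moreover have "coprime (int p ^ 2) 2"
    using coprime_small[of 2 2] gt3 by (simp add: coprime_commute)
  ultimately show ?thesis by (metis coprime_dvd_mult_right_iff)
qed

text \<open>The term is itself a multiple of p, so the part 2p of its denominator 2p - 3 disappears
  modulo p^2.\<close>

lemma W_delannoy_term_self: "[3 * W_delannoy_term p = - 4 * int p] (mod int p ^ 2)"
proof -
  have eq: "(2 * int p - 3) * W_delannoy_term p = 2 * int p * int ((2 * p) choose p)"
    using W_delannoy_term_eq[of p] by (simp add: mult_2[symmetric])
  have "\<not> int p dvd 3" using gt3 by (auto dest: zdvd_imp_le)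
  moreover have "int p dvd 3 * W_delannoy_term p"
  proof -
    have "3 * W_delannoy_term p = int p * (2 * W_delannoy_term p - 2 * int ((2 * p) choose p))"
      using eq by (simp add: algebra_simps)
    then show ?thesis by simp
  qed
  ultimately have "int p dvd W_delannoy_term p" using prime by (simp add: prime_dvd_mult_iff)
  then have "[2 * (int p * W_delannoy_term p) = 0] (mod int p ^ 2)"
    by (simp add: cong_0_iff power2_eq_square)
  moreover have "[2 * int p * int ((2 * p) choose p) = 2 * int p * 2] (mod int p ^ 2)"
    by (intro cong_mult cong_refl central_binomial_cong)
  ultimately have "[2 * (int p * W_delannoy_term p) - 2 * int p * int ((2 * p) choose p) = 0 - 2 * int p * 2] (mod int p ^ 2)"
    by (rule cong_diff)
  moreover have "2 * (int p * W_delannoy_term p) - 2 * int p * int ((2 * p) choose p) = 3 * W_delannoy_term p"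
    using eq by (simp add: algebra_simps)
  ultimately show ?thesis by simp
qed

text \<open>Here 2k - 3 = p cancels the factor p of the numerator exactly, before any
  reduction.\<close>

lemma W_delannoy_term_middle:
  assumes "2 * k = p + 3"
  shows "[3 * W_delannoy_term k = - (6 + 4 * int p) * (-1) ^ k] (mod int p ^ 2)"
proof -
  obtain j where j: "k = Suc j" using assms by (cases k) auto
  define b where "b = int ((p - 1) choose j) * int ((p + j) choose j)"
  have p: "int p = 2 * int j - 1" using assms j by simp
  have "int p * ((int j + 1) * W_delannoy_term k) = int p * (2 * (int p + int j + 1) * b)"
    using W_delannoy_term_product[of j, folded b_def] assms gt3 unfolding j p by (simp add: mult_ac)
  then have "(int j + 1) * W_delannoy_term k = 2 * (int p + int j + 1) * b"
    using gt3 by simp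
  then have "(int p + 3) * W_delannoy_term k = 6 * (int p + 1) * b"
    unfolding p by (simp add: algebra_simps)
  \<comment> \<open>Multiplication by 3 - p turns the factor p + 3 into 9 - p^2.\<close>
  then have "3 * (3 * W_delannoy_term k) - 3 * ((6 + 4 * int p) * b) = int p ^ 2 * (W_delannoy_term k - 6 * b)"
    by Groebner_Basis.algebra
  then have "[3 * (3 * W_delannoy_term k) = 3 * ((6 + 4 * int p) * b)] (mod int p ^ 2)"
    by (simp add: cong_iff_dvd_diff)
  moreover have "coprime 3 (int p ^ 2)" using coprime_small[of 3 2] gt3 by simp
  ultimately have "[3 * W_delannoy_term k = (6 + 4 * int p) * b] (mod int p ^ 2)"
    by (simp only: cong_mult_lcancel)
  also have "[(6 + 4 * int p) * b = (6 + 4 * int p) * (-1) ^ j] (mod int p ^ 2)"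
    unfolding b_def by (intro cong_mult cong_refl binomial_product_cong) (use assms j gt3 in simp)
  finally show ?thesis by (simp add: j algebra_simps)
qed

lemma W_plus_delannoy_cong:
  defines "e \<equiv> (-1) ^ ((p - 1) div 2)"
  shows "[3 * (W p + delannoy p) = - 6 * e - int p * (4 * e + 14)] (mod int p ^ 2)"
proof -
  let ?A = "{k. 3 < k \<and> k < p \<and> 2 * k \<noteq> p + 3}"
  have "odd p" using prime_odd_nat[OF prime] gt3 by simp
  then obtain m where m: "p = 2 * m + 1" by (elim oddE)
  define k where "k = m + 2"
  have k: "2 * k = p + 3" "3 < k" "k < p" "(-1) ^ k = e"
    using m gt3 by (auto simp: k_def e_def)
  \<comment> \<open>The reflection sends 1, 2, 3 to p + 2, p + 1, p, and \<open>k\<close> is its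
    fixed point, so these indices are treated singly. The term at 0 vanishes.\<close>
  have "{..p} = {0, 1, 2, 3, p, k} \<union> ?A"
    using k gt3 by auto
  then have "W p + delannoy p = sum W_delannoy_term ({0, 1, 2, 3, p, k} \<union> ?A)"
    unfolding W_plus_delannoy W_delannoy_term_def by simp
  also have "\<dots> = sum W_delannoy_term {0, 1, 2, 3, p, k} + sum W_delannoy_term ?A"
    using k gt3 by (intro sum.union_disjoint) auto
  also have "sum W_delannoy_term {0, 1, 2, 3, p, k} = W_delannoy_term 1 + W_delannoy_term 2 + W_delannoy_term 3 + W_delannoy_term p + W_delannoy_term k"
    using k gt3 by (simp add: W_delannoy_term_def[of 0] W_coeff_def)
  finally have sum: "3 * (W p + delannoy p)
    = 3 * W_delannoy_term 2 - 3 * (- W_delannoy_term 1) + 3 * W_delannoy_term 3 + 3 * W_delannoy_term p + 3 * W_delannoy_term k + 3 * sum W_delannoy_term ?A"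
    by simp
  have "[- W_delannoy_term 1 = 2 * int p] (mod int p ^ 2)" "[W_delannoy_term 2 = - 2 * int p] (mod int p ^ 2)"
    "[3 * W_delannoy_term 3 = 2 * int p] (mod int p ^ 2)"
    using W_delannoy_term_cong[of 1] W_delannoy_term_cong[of 2] W_delannoy_term_cong[of 3] gt3 by simp_all
  moreover have "[sum W_delannoy_term ?A = 0] (mod int p ^ 2)"
    using W_delannoy_term_pairs_sum by (simp add: cong_0_iff)
  ultimately have "[3 * (W p + delannoy p) = 3 * (- 2 * int p) - 3 * (2 * int p) + 2 * int p + (- 4 * int p)
      + - (6 + 4 * int p) * e + 3 * 0] (mod int p ^ 2)"
    unfolding sum k(4)[symmetric]
    by (intro cong_add cong_diff cong_mult[OF cong_refl] W_delannoy_term_self W_delannoy_term_middle k(1))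
  then show ?thesis by (simp add: algebra_simps)
qed

section \<open>The weighted sum modulo p^3\<close>

lemma sum_W_squared_cong:
  "[(\<Sum>k<p. (2 * int k + 1) * (W k)^2) = 12 * int p * (-1) ^ ((p - 1) div 2) - 17 * (int p)^2] (mod int p ^ 3)"
proof -
  define N where "N = int p"
  define S where "S = (\<Sum>k<p. (2 * int k + 1) * (W k)^2)"
  define u where "u = delannoy p + delannoy (p - 1)"
  define v where "v = W p + delannoy p"
  define d where "d = delannoy p"
  define e :: int where "e = (-1) ^ ((p - 1) div 2)"
  define q where "q = ((2 * N - 1) * (2 * N + 1) * (2 * N + 3))^2"
  have "8 * q * S = - closed_form N (W p) d (N * u)"
    using sum_W_squared[of p] by (simp add: N_def S_def u_def d_def q_def)
  moreover have "W p + d = v" by (simp add: v_def d_def)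
  ultimately obtain R where R: "8 * q * S
      = - (N * (108 * u * v + N * (8 * (45 * v^2 - 45 * d^2 + 9 * u * v + 54 * d * u) - 9 * u^2) + N^2 * (8 * R)))"
    using closed_form_expansion[of N "W p" d u] by metis
  have ee: "e * e = 1" by (simp add: e_def power_mult_distrib[symmetric])
  have u2: "[u = 4] (mod N ^ 2)" and d1: "[d = 3] (mod N)"
    and v2: "[3 * v = - 6 * e - N * (4 * e + 14)] (mod N ^ 2)"
    using delannoy_sum_cong delannoy_cong W_plus_delannoy_cong
    by (simp_all add: u_def d_def v_def e_def N_def)
  have dvd: "N dvd N ^ 2" by (simp add: power2_eq_square)
  have u1: "[u = 4] (mod N)" using u2 dvd by (rule cong_dvd_modulus)
  have "[3 * v = - 6 * e - N * (4 * e + 14)] (mod N)" using v2 dvd by (rule cong_dvd_modulus)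
  also have "[- 6 * e - N * (4 * e + 14) = - 6 * e] (mod N)" by (simp add: cong_iff_dvd_diff)
  finally have v1: "[3 * v = - 6 * e] (mod N)" .
  \<comment> \<open>The product uv carries one factor N in the expansion, so it is needed modulo
    N^2; the bracket below carries N^2 and is needed modulo N only. As \<open>v\<close> is known
    through 3v, both are written in 3v.\<close>
  obtain x where x: "u * (3 * v) = 4 * (- 6 * e - N * (4 * e + 14)) + N ^ 2 * x"
    using cong_mult[OF u2 v2] by (metis cong_iff_lin cong_sym)
  obtain y where y: "40 * ((3 * v) * (3 * v)) - 360 * (d * d) + 24 * (u * (3 * v)) + 432 * (d * u) - 9 * (u * u)
    = 40 * ((- 6 * e) * (- 6 * e)) - 360 * (3 * 3) + 24 * (4 * (- 6 * e)) + 432 * (3 * 4) - 9 * (4 * 4) + N * y"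
    using cong_diff[OF cong_add[OF cong_add[OF cong_diff[OF
      cong_scalar_left[OF cong_mult[OF v1 v1], of 40] cong_scalar_left[OF cong_mult[OF d1 d1], of 360]]
      cong_scalar_left[OF cong_mult[OF u1 v1], of 24]] cong_scalar_left[OF cong_mult[OF d1 u1], of 432]]
      cong_scalar_left[OF cong_mult[OF u1 u1], of 9]]
    by (metis cong_iff_lin cong_sym)
  have y': "360 * v^2 - 360 * d^2 + 72 * u * v + 432 * d * u - 9 * u^2
     = 3240 - 576 * e + N * y"
  proof -
    have "(- 6 * e) * (- 6 * e) = 36 * (e * e)" by simp
    then show ?thesis using y unfolding ee by (simp add: power2_eq_square algebra_simps)
  qed
  have "8 * q * S = - (N * (36 * (u * (3 * v)) + N * (360 * v^2 - 360 * d^2 + 72 * u * v + 432 * d * u - 9 * u^2) + N^2 * (8 * R)))"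
    unfolding R by (simp add: algebra_simps)
  also have "\<dots> = 864 * N * e - 1224 * N^2 + 1152 * N^2 * e - N^3 * (36 * x + y + 8 * R)"
    unfolding x y' by Groebner_Basis.algebra
  \<comment> \<open>Since q = 9 + 12N + ..., the linear term of q produces exactly 1152 N^2 e = 8 *
    12 * 12 N^2 e.\<close>
  also have "\<dots> = 8 * q * (12 * N * e - 17 * N^2) - N^3 * (36 * x + y + 8 * R
     + 8 * ((- 68 - 96*N + 112*N^2 + 192*N^3 + 64*N^4) * (12 * e - 17 * N) - 17 * 12))"
    unfolding q_def by Groebner_Basis.algebra
  finally have "[8 * q * S = 8 * q * (12 * N * e - 17 * N^2)] (mod N ^ 3)"
    by (simp add: cong_iff_dvd_diff)
  moreover have "coprime (8 * q) (N ^ 3)"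
    unfolding N_def
  proof (rule coprime_int_prime_power)
    have q: "8 * q = N * (8 * (12 - 68*N - 96*N^2 + 112*N^3 + 192*N^4 + 64*N^5)) + 2 ^ 3 * 3 ^ 2"
      unfolding q_def by Groebner_Basis.algebra
    have "\<not> int p dvd 2" "\<not> int p dvd 3" using gt3 by (auto dest: zdvd_imp_le)
    then have "\<not> int p dvd 2 ^ 3 * 3 ^ 2"
      using prime prime_dvd_mult_iff prime_dvd_power by (metis prime_int_nat_transfer prime_nat_int_transfer)
    then show "\<not> int p dvd 8 * q"
      unfolding q N_def by (simp add: dvd_add_right_iff)
  qed
  ultimately have "[S = 12 * N * e - 17 * N^2] (mod N ^ 3)"
    by (simp only: cong_mult_lcancel)
  then show ?thesis unfolding N_def S_def e_def .
qed

end

theorem theorem1p2: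
  fixes n p :: nat
  assumes "n > 0" and "prime p" and "p > 3"
  shows "[9 * (\<Sum>k=0..n-1. (2 * int k + 1) * (W k)\<^sup>2) = 0] (mod int n) \<and>
         [(\<Sum>k=0..p-1. (2 * int k + 1) * (W k)\<^sup>2)
            = 12 * int p * (-1) ^ ((p - 1) div 2) - 17 * (int p)\<^sup>2] (mod (int p) ^ 3)"
proof -
  have "{0..m - 1} = {..<m}" if "m > 0" for m :: nat using that by auto
  then show ?thesis
    using assms dvd_nine_sum[of n] sum_W_squared_cong[of p] by (simp add: cong_0_iff)
qed

end
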